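(* $N(\mathbb{H}_s)=\{q=q_1\mathbf{i}+q_2\mathbf{j}+q_3\mathbf{k}: q_1,q_2,q_3\in\mathbb{R},\ q_1^2-q_2^2-q_3^2=0\}$.
   Context: $\mathbb{H}_s=\{q_0+q_1\mathbf{i}+q_2\mathbf{j}+q_3\mathbf{k}: q_i\in\mathbb{R}\}$ is the real associative algebra of split quaternions with $\mathbf{i}^2=-1$, $\mathbf{j}^2=\mathbf{k}^2=1$, $\mathbf{i}\mathbf{j}=\mathbf{k}=-\mathbf{j}\mathbf{i}$, $\mathbf{j}\mathbf{k}=-\mathbf{i}=-\mathbf{k}\mathbf{j}$, $\mathbf{k}\mathbf{i}=\mathbf{j}=-\mathbf{i}\mathbf{k}$. $N(\mathbb{H}_s)$ is the set of nilpotent elements: $N(\mathbb{H}_s)=\{q\in\mathbb{H}_s:\text{there is an integer } n\ge1 \text{ such that } q^n=0\}$. *)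

theory Defs
  imports Complex_Main
begin

text \<open>
  \<open>SQuat q0 q1 q2 q3\<close> stands for \<open>q0 + q1 i + q2 j + q3 k\<close>. As for type \<^typ>\<open>complex\<close>, a
  codatatype is used only to obtain definitions by selectors.
\<close>

codatatype split_quat =
  SQuat (sq_re: real) (sq_im1: real) (sq_im2: real) (sq_im3: real)

lemma split_quat_eq_iff:
  "p = q \<longleftrightarrow> sq_re p = sq_re q \<and> sq_im1 p = sq_im1 q \<and> sq_im2 p = sq_im2 q \<and> sq_im3 p = sq_im3 q"
  by (auto intro: split_quat.expand)

text \<open>
  The product is the bilinear extension of \<open>i i = -1\<close>, \<open>j j = k k = 1\<close>, \<open>i j = k = - j i\<close>,
  \<open>j k = - i = - k j\<close>, \<open>k i = j = - i k\<close>; these relations are derived below.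
\<close>

instantiation split_quat :: real_algebra_1
begin

primcorec zero_split_quat where
  "sq_re 0 = 0"
| "sq_im1 0 = 0"
| "sq_im2 0 = 0"
| "sq_im3 0 = 0"

primcorec one_split_quat where
  "sq_re 1 = 1"
| "sq_im1 1 = 0"
| "sq_im2 1 = 0"
| "sq_im3 1 = 0"

primcorec plus_split_quat where
  "sq_re (p + q) = sq_re p + sq_re q"
| "sq_im1 (p + q) = sq_im1 p + sq_im1 q"
| "sq_im2 (p + q) = sq_im2 p + sq_im2 q"
| "sq_im3 (p + q) = sq_im3 p + sq_im3 q"

primcorec uminus_split_quat where
  "sq_re (- p) = - sq_re p"
| "sq_im1 (- p) = - sq_im1 p"
| "sq_im2 (- p) = - sq_im2 p"
| "sq_im3 (- p) = - sq_im3 p"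

primcorec minus_split_quat where
  "sq_re (p - q) = sq_re p - sq_re q"
| "sq_im1 (p - q) = sq_im1 p - sq_im1 q"
| "sq_im2 (p - q) = sq_im2 p - sq_im2 q"
| "sq_im3 (p - q) = sq_im3 p - sq_im3 q"

primcorec scaleR_split_quat where
  "sq_re (scaleR r q) = r * sq_re q"
| "sq_im1 (scaleR r q) = r * sq_im1 q"
| "sq_im2 (scaleR r q) = r * sq_im2 q"
| "sq_im3 (scaleR r q) = r * sq_im3 q"

primcorec times_split_quat where
  "sq_re (p * q) =
     sq_re p * sq_re q - sq_im1 p * sq_im1 q + sq_im2 p * sq_im2 q + sq_im3 p * sq_im3 q"
| "sq_im1 (p * q) =
     sq_re p * sq_im1 q + sq_im1 p * sq_re q - sq_im2 p * sq_im3 q + sq_im3 p * sq_im2 q"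
| "sq_im2 (p * q) =
     sq_re p * sq_im2 q + sq_im2 p * sq_re q - sq_im1 p * sq_im3 q + sq_im3 p * sq_im1 q"
| "sq_im3 (p * q) =
     sq_re p * sq_im3 q + sq_im3 p * sq_re q + sq_im1 p * sq_im2 q - sq_im2 p * sq_im1 q"

instance
  by standard (simp_all add: split_quat_eq_iff algebra_simps)

end

definition sq_i :: split_quat where "sq_i = SQuat 0 1 0 0"
definition sq_j :: split_quat where "sq_j = SQuat 0 0 1 0"
definition sq_k :: split_quat where "sq_k = SQuat 0 0 0 1"

lemma split_quat_units_mult:
  "sq_i * sq_i = - 1" "sq_j * sq_j = 1" "sq_k * sq_k = 1"
  "sq_i * sq_j = sq_k" "sq_j * sq_i = - sq_k"
  "sq_j * sq_k = - sq_i" "sq_k * sq_j = sq_i"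
  "sq_k * sq_i = sq_j" "sq_i * sq_k = - sq_j"
  by (simp_all add: split_quat_eq_iff sq_i_def sq_j_def sq_k_def)

lemma SQuat_eq:
  "SQuat q0 q1 q2 q3 = of_real q0 + q1 *\<^sub>R sq_i + q2 *\<^sub>R sq_j + q3 *\<^sub>R sq_k"
  by (simp add: split_quat_eq_iff sq_i_def sq_j_def sq_k_def of_real_def)

definition nilpotents :: "split_quat set" where
  "nilpotents = {q. \<exists>n::nat. n \<ge> 1 \<and> q ^ n = 0}"

end

theory Submission
  imports Defs
begin

text \<open>
  Every split quaternion \<open>q\<close> with real part \<open>q0\<close> satisfies the quadratic equation
  \<open>q\<^sup>2 = 2 q0 q - N(q)\<close>, where \<open>N(q) = q0\<^sup>2 + q1\<^sup>2 - q2\<^sup>2 - q3\<^sup>2\<close> is a multiplicative quadratic form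
  (under the identification of the split quaternions with the real \<open>2 \<times> 2\<close> matrices, \<open>N\<close> is the
  determinant and \<open>2 q0\<close> the trace). If \<open>q\<^sup>n = 0\<close> with \<open>n \<ge> 1\<close>, then \<open>N(q)\<^sup>n = 0\<close>, so \<open>N(q) = 0\<close> and
  the quadratic equation becomes \<open>q\<^sup>2 = 2 q0 q\<close>. Hence \<open>q\<^sup>n = (2 q0)\<^sup>n\<^sup>-\<^sup>1 q\<close>, and comparing real
  parts gives \<open>q0 = 0\<close>. Conversely, \<open>q0 = 0\<close> and \<open>N(q) = 0\<close> give \<open>q\<^sup>2 = 0\<close> at once.
\<close>

definition quat_norm :: "split_quat \<Rightarrow> real" where
  "quat_norm q = (sq_re q)\<^sup>2 + (sq_im1 q)\<^sup>2 - (sq_im2 q)\<^sup>2 - (sq_im3 q)\<^sup>2"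

lemma quat_norm_mult: "quat_norm (p * q) = quat_norm p * quat_norm q"
  by (simp add: quat_norm_def power2_eq_square algebra_simps)

lemma quat_norm_power: "quat_norm (q ^ n) = quat_norm q ^ n"
proof (induction n)
  case 0
  show ?case by (simp add: quat_norm_def)
next
  case (Suc n)
  then show ?case by (simp add: quat_norm_mult)
qed

text \<open>
  The Cayley-Hamilton equation: it holds because \<open>2 q0 - q\<close> is the conjugate of \<open>q\<close>, whose product
  with \<open>q\<close> is \<open>N(q)\<close>.
\<close>

lemma quadratic_equation: "q * q = (2 * sq_re q) *\<^sub>R q - of_real (quat_norm q)"
  by (simp add: split_quat_eq_iff of_real_def quat_norm_def power2_eq_square)

lemma power_Suc_of_norm_zero:
  assumes "quat_norm q = 0"
  shows "q ^ Suc n = (2 * sq_re q) ^ n *\<^sub>R q"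
proof (induction n)
  case 0
  show ?case by simp
next
  case (Suc n)
  have "q ^ Suc (Suc n) = q * q ^ Suc n"
    by (rule power_Suc)
  also have "\<dots> = (2 * sq_re q) ^ n *\<^sub>R (q * q)"
    unfolding Suc.IH by simp
  also have "q * q = (2 * sq_re q) *\<^sub>R q"
    using quadratic_equation[of q] assms by simp
  finally show ?case by (simp add: mult.commute)
qed

lemma nilpotent_iff: "q \<in> nilpotents \<longleftrightarrow> sq_re q = 0 \<and> quat_norm q = 0"
proof
  assume "q \<in> nilpotents"
  then obtain n where n: "n \<ge> 1" "q ^ n = 0"
    unfolding nilpotents_def by blast
  obtain m where "n = Suc m"
    using n(1) by (cases n) simp_all
  with n have m: "q ^ Suc m = 0"
    by (simp only:)
  have "quat_norm q ^ Suc m = quat_norm 0"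
    using quat_norm_power[of q "Suc m"] m by simp
  also have "\<dots> = 0"
    by (simp add: quat_norm_def)
  finally have N: "quat_norm q = 0"
    by (simp only: power_eq_0_iff)
  have "(2 * sq_re q) ^ m *\<^sub>R q = 0"
    using power_Suc_of_norm_zero[OF N, of m] m by simp
  \<comment> \<open>Read off the real part, so that the degenerate case \<open>q = 0\<close> needs no separate treatment.\<close>
  then have "(2 * sq_re q) ^ m * sq_re q = 0"
    by (auto simp: split_quat_eq_iff)
  then have "sq_re q = 0"
    by auto
  with N show "sq_re q = 0 \<and> quat_norm q = 0" by simp
next
  assume "sq_re q = 0 \<and> quat_norm q = 0"
  then have "q ^ 2 = 0"
    using quadratic_equation[of q] by (simp add: power2_eq_square)
  then show "q \<in> nilpotents"
    unfolding nilpotents_def by (intro CollectI exI[of _ 2]) simp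
qed

theorem proposition2p2:
  shows "nilpotents =
    {q. \<exists>q1 q2 q3 :: real. q = q1 *\<^sub>R sq_i + q2 *\<^sub>R sq_j + q3 *\<^sub>R sq_k
                        \<and> q1\<^sup>2 - q2\<^sup>2 - q3\<^sup>2 = 0}"
proof -
  have "q = q1 *\<^sub>R sq_i + q2 *\<^sub>R sq_j + q3 *\<^sub>R sq_k \<longleftrightarrow>
      sq_re q = 0 \<and> sq_im1 q = q1 \<and> sq_im2 q = q2 \<and> sq_im3 q = q3" for q q1 q2 q3
    by (simp add: split_quat_eq_iff sq_i_def sq_j_def sq_k_def)
  then show ?thesis
    by (simp add: set_eq_iff nilpotent_iff quat_norm_def cong: conj_cong)
qed

end
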